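(* Let $s\in(0,1]$, $m>1$, $n\in\mathbb N$ with $n>2s$, $o\in\mathbb R^n$, and set $\alpha:=\frac{n}{n(m-1)+2s}$, $\beta:=\frac{2s}{n(m-1)+2s}$. Let $a,b\in\mathbb R$. For nonnegative data $u_0$, let $u$ denote the weak dual solution of $\partial_tu+(-\Delta)^s(u^m)=0$ in $(0,\infty)\times\mathbb R^n$, $u(0,\cdot)=u_0$. The short-time smoothing estimates with exponents $(\alpha,\beta)$ are uniformly sharp on $\mathbb R^n$, both in the time exponent and in the initial-data exponent. Precisely, suppose that at least one of the following holds: (i) for every nonempty compact $K\subset\mathbb R^n$ there is $C_K>0$ such that $\|u(t)\|_{L^\infty(K)}\le C_K\,t^{-a}\|u_0\|_{L^1(\mathbb R^n)}^{b}$ for all nonnegative $u_0\in L^1(\mathbb R^n)$, $u_0\not\equiv0$, and all $0<t\le\|u_0\|_{L^1(\mathbb R^n)}^{-(m-1)}$; (ii) for every nonempty compact $K\subset\mathbb R^n$ there is $C_{K,o}>0$ such that $\|u(t)\|_{L^\infty(K)}\le C_{K,o}\,t^{-a}\|u_0\|_{L^1_{G^s_{\mathbb R^n},o}(\mathbb R^n)}^{b}$ for all nonnegative $u_0\in L^1_{G^s_{\mathbb R^n},o}(\mathbb R^n)$, $u_0\not\equiv0$, and all $0<t\le\|u_0\|_{L^1_{G^s_{\mathbb R^n},o}(\mathbb R^n)}^{-(m-1)}$; (iii) there is $C>0$ such that $\|u(t)\|_{L^\infty(\mathbb R^n)}\le C\,t^{-a}\|u_0\|_{L^1(\mathbb R^n)}^{b}$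 for all nonnegative $u_0\in L^1(\mathbb R^n)$, $u_0\not\equiv0$, and all $0<t\le\|u_0\|_{L^1(\mathbb R^n)}^{-(m-1)}$; (iv) there is $C>0$ such that $\|u(t)\|_{L^\infty(\mathbb R^n)}\le C\,t^{-a}\|u_0\|_{L^1_{G^s_{\mathbb R^n}}(\mathbb R^n)}^{b}$ for all nonnegative $u_0\in L^1_{G^s_{\mathbb R^n}}(\mathbb R^n)$, $u_0\not\equiv0$, and all $0<t\le\|u_0\|_{L^1_{G^s_{\mathbb R^n}}(\mathbb R^n)}^{-(m-1)}$. Then $a\ge\alpha$; and if $a=\alpha$, then $b=\beta$.
   Context: For $s\in(0,1)$, $(-\Delta)^s$ is the spectral fractional power of $-\Delta$ on $\mathbb R^n$; $(-\Delta)^1=-\Delta$. The Green function is $G^s_{\mathbb R^n}(x,y)=\frac1{\Gamma(s)}\int_0^\infty p(t,x,y)t^{s-1}dt=c_{n,s}|x-y|^{-(n-2s)}$ with $p$ the heat kernel, and $(-\Delta)^{-s}\psi(x):=\int_{\mathbb R^n}G^s_{\mathbb R^n}(x,y)\psi(y)\,dy$. $u(t)$ means $u(t,\cdot)$. Green-weighted spaces: $\|v\|_{L^1_{G^s_{\mathbb R^n},x_0}(\mathbb R^n)}:=\int_{B_1(x_0)}|v|\,dx+\int_{\mathbb R^n\setminus B_1(x_0)}|v(x)|G^s_{\mathbb R^n}(x,x_0)\,dx$ and $\|v\|_{L^1_{G^s_{\mathbb R^n}}(\mathbb R^n)}:=\sup_{x_0\in\mathbb R^n}\|v\|_{L^1_{G^s_{\mathbb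 R^n},x_0}(\mathbb R^n)}$; the spaces consist of measurable functions with finite norm. Weak dual solution (WDS): a measurable $u\ge0$ such that for every $T>0$: (i) $u\in C([0,T];L^1_{G^s_{\mathbb R^n},x_0}(\mathbb R^n))$ for all $x_0$; (ii) $u^m\in L^1((0,T);L^1_{\rm loc}(\mathbb R^n))$; (iii) for all $\psi\in C^1_c((0,T);L^\infty_c(\mathbb R^n))$ (bounded, with spatial supports in a common compact set), $\int_0^T\int\partial_t\psi\,(-\Delta)^{-s}u\,dx\,dt=\int_0^T\int u^m\psi\,dx\,dt$; (iv) $u(0)=u_0$ a.e. "The weak dual solution with datum $u_0$" means the one obtained by monotone approximation: take any nondecreasing sequence $0\le u_{0,k}\in L^1\cap L^\infty$ with $u_{0,k}\uparrow u_0$ a.e., let $u_k$ be the mild solution with datum $u_{0,k}$ (the $L^1$ nonlinear semigroup solution, i.e. the limit in $C([0,T];L^1)$, for every $T>0$, of the implicit Euler scheme $\frac T\ell(-\Delta)^s(v_{j+1}^m)+v_{j+1}=v_j$, $v_0=u_{0,k}$, as $\ell\to\infty$), and set $u=\lim_ku_k$ (monotone limit). It is a WDS and does not depend on the chosen sequence. An estimate is called uniformly sharp if its exponents cannot be improved while keeping the constant independent of both the initial datum and time in the relevant regime. With $(a,b)=(\alpha,\beta)$ all four estimates (i)--(iv) hold. *)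

theory Defs
  imports "HOL-Analysis.Analysis" "HOL-Probability.Essential_Supremum"
begin

text \<open>
  Euclidean space is \<^typ>\<open>'a::euclidean_space\<close>, with dimension n = DIM('a).  Elements of Lebesgue
  spaces are represented by Borel functions, identified up to \<^const>\<open>lborel\<close>-null sets.
\<close>

subsection \<open>Green function and function spaces\<close>

definition heat_kernel :: "real \<Rightarrow> 'a::euclidean_space \<Rightarrow> 'a \<Rightarrow> real" where
  "heat_kernel t x y =
     (4 * pi * t) powr (- real DIM('a) / 2) * exp (- (norm (x - y))\<^sup>2 / (4 * t))"

text \<open>
  For n > 2s the integral diverges exactly on the diagonal, where the Bochner integral takes the
  default value 0; all uses below are under an integral in one of the two variables.
\<close>

definition green :: "real \<Rightarrow> 'a::euclidean_space \<Rightarrow> 'a \<Rightarrow> real" where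
  "green s x y =
     1 / Gamma s * set_lebesgue_integral lborel {0<..} (\<lambda>t. heat_kernel t x y * t powr (s - 1))"

definition inv_frac_laplacian ::
    "real \<Rightarrow> ('a::euclidean_space \<Rightarrow> real) \<Rightarrow> 'a \<Rightarrow> real" where
  "inv_frac_laplacian s f x = (LINT y|lborel. green s x y * f y)"

definition L1_norm :: "('a::euclidean_space \<Rightarrow> real) \<Rightarrow> ennreal" where
  "L1_norm f = (\<integral>\<^sup>+ x. ennreal \<bar>f x\<bar> \<partial>lborel)"

definition Linf_norm :: "'a::euclidean_space set \<Rightarrow> ('a \<Rightarrow> real) \<Rightarrow> ennreal" where
  "Linf_norm K f = esssup (restrict_space lborel K) (\<lambda>x. ennreal \<bar>f x\<bar>)"

definition green_norm_at ::
    "real \<Rightarrow> 'a \<Rightarrow> ('a::euclidean_space \<Rightarrow> real) \<Rightarrow> ennreal" where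
  "green_norm_at s x0 f =
     (\<integral>\<^sup>+ x\<in>ball x0 1. ennreal \<bar>f x\<bar> \<partial>lborel)
   + (\<integral>\<^sup>+ x\<in>- ball x0 1. ennreal (\<bar>f x\<bar> * green s x x0) \<partial>lborel)"

definition green_norm :: "real \<Rightarrow> ('a::euclidean_space \<Rightarrow> real) \<Rightarrow> ennreal" where
  "green_norm s f = (SUP x0. green_norm_at s x0 f)"

definition L1_space :: "('a::euclidean_space \<Rightarrow> real) set" where
  "L1_space = {f \<in> borel_measurable borel. L1_norm f < \<infinity>}"

definition Linf_space :: "('a::euclidean_space \<Rightarrow> real) set" where
  "Linf_space = {f \<in> borel_measurable borel. Linf_norm UNIV f < \<infinity>}"

definition green_space_at :: "real \<Rightarrow> 'a \<Rightarrow> ('a::euclidean_space \<Rightarrow> real) set" where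
  "green_space_at s x0 = {f \<in> borel_measurable borel. green_norm_at s x0 f < \<infinity>}"

definition green_space :: "real \<Rightarrow> ('a::euclidean_space \<Rightarrow> real) set" where
  "green_space s = {f \<in> borel_measurable borel. green_norm s f < \<infinity>}"

definition nonneg_ae :: "('a::euclidean_space \<Rightarrow> real) \<Rightarrow> bool" where
  "nonneg_ae f \<longleftrightarrow> (AE x in lborel. 0 \<le> f x)"

definition null_ae :: "('a::euclidean_space \<Rightarrow> real) \<Rightarrow> bool" where
  "null_ae f \<longleftrightarrow> (AE x in lborel. f x = 0)"


subsection \<open>The spectral fractional Laplacian\<close>

definition fourier :: "('a::euclidean_space \<Rightarrow> real) \<Rightarrow> 'a \<Rightarrow> complex" where
  "fourier f \<xi> = (LINT x|lborel. complex_of_real (f x) * cis (- (x \<bullet> \<xi>)))"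

text \<open>
  The Fourier transform diagonalises the negative Laplacian on L2, with multiplier equal to the
  squared norm of the frequency, so its spectral power of order s is the multiplier
  \<open>norm \<xi> powr (2 * s)\<close>.  The operator is only needed between functions in the intersection of L1 and
  Linf (hence in L2); there the Plancherel transform is given by the integral above and is
  continuous, so that the identity can be required at every frequency.
\<close>

definition frac_laplacian_eq ::
    "real \<Rightarrow> ('a::euclidean_space \<Rightarrow> real) \<Rightarrow> ('a \<Rightarrow> real) \<Rightarrow> bool" where
  "frac_laplacian_eq s w g \<longleftrightarrow>
     w \<in> L1_space \<inter> Linf_space \<and> g \<in> L1_space \<inter> Linf_space \<and>
     (\<forall>\<xi>. complex_of_real (norm \<xi> powr (2 * s)) * fourier w \<xi> = fourier g \<xi>)"


subsection \<open>Mild solutions\<close>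

text \<open>\<open>(T / l) * (-Laplacian)^s ((v (j+1))^m) + v (j+1) = v j\<close> for j < l, with \<open>v 0 = f\<close>.\<close>

definition implicit_euler ::
    "real \<Rightarrow> real \<Rightarrow> real \<Rightarrow> nat \<Rightarrow> ('a::euclidean_space \<Rightarrow> real) \<Rightarrow> (nat \<Rightarrow> 'a \<Rightarrow> real) \<Rightarrow> bool" where
  "implicit_euler s m T l f v \<longleftrightarrow>
     v 0 = f \<and>
     (\<forall>j\<le>l. v j \<in> L1_space \<inter> Linf_space \<and> nonneg_ae (v j)) \<and>
     (\<forall>j<l. frac_laplacian_eq s (\<lambda>x. v (Suc j) x powr m) (\<lambda>x. (v j x - v (Suc j) x) / (T / real l)))"

text \<open>
  Being the limit of the scheme means that the scheme is solvable for every number of steps and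
  that its solutions, interpolated as piecewise constant functions of time, converge in L1
  uniformly on [0,T].  Each step determines \<open>v (Suc j)\<close> only up to null sets, so the convergence
  is stated for every choice of solutions of the schemes.
\<close>

definition mild_solution ::
    "real \<Rightarrow> real \<Rightarrow> ('a::euclidean_space \<Rightarrow> real) \<Rightarrow> (real \<Rightarrow> 'a \<Rightarrow> real) \<Rightarrow> bool" where
  "mild_solution s m f u \<longleftrightarrow>
     (\<forall>t\<ge>0. u t \<in> L1_space) \<and>
     (\<forall>t0\<ge>0. ((\<lambda>t. L1_norm (\<lambda>x. u t x - u t0 x)) \<longlongrightarrow> 0) (at t0 within {0..})) \<and>
     (\<forall>T>0.
        (\<forall>l>0. \<exists>v. implicit_euler s m T l f v) \<and>
        (\<forall>V. (\<forall>l>0. implicit_euler s m T l f (V l)) \<longrightarrow>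
           (\<lambda>l. SUP t\<in>{0..T}. L1_norm (\<lambda>x. V l (nat \<lceil>t / (T / real l)\<rceil>) x - u t x)) \<longlonglongrightarrow> 0))"


subsection \<open>Weak dual solutions\<close>

text \<open>
  \<open>\<psi>\<close> is a continuously differentiable, compactly supported map from (0,T) to Linf with spatial
  supports in a common compact set, and \<open>\<psi>'\<close> is its time derivative (a limit in Linf).
\<close>

definition test_function ::
    "real \<Rightarrow> (real \<Rightarrow> 'a::euclidean_space \<Rightarrow> real) \<Rightarrow> (real \<Rightarrow> 'a \<Rightarrow> real) \<Rightarrow> bool" where
  "test_function T \<psi> \<psi>' \<longleftrightarrow>
     (\<forall>t\<in>{0<..<T}. \<psi> t \<in> Linf_space \<and> \<psi>' t \<in> Linf_space \<and>
        ((\<lambda>\<tau>. Linf_norm UNIV (\<lambda>x. (\<psi> \<tau> x - \<psi> t x) / (\<tau> - t) - \<psi>' t x)) \<longlongrightarrow> 0) (at t) \<and>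
        ((\<lambda>\<tau>. Linf_norm UNIV (\<lambda>x. \<psi>' \<tau> x - \<psi>' t x)) \<longlongrightarrow> 0) (at t)) \<and>
     (\<exists>J K. compact J \<and> J \<subseteq> {0<..<T} \<and> compact K \<and>
        (\<forall>t\<in>{0<..<T}. AE x in lborel. t \<notin> J \<or> x \<notin> K \<longrightarrow> \<psi> t x = 0))"

definition weak_dual_solution ::
    "real \<Rightarrow> real \<Rightarrow> ('a::euclidean_space \<Rightarrow> real) \<Rightarrow> (real \<Rightarrow> 'a \<Rightarrow> real) \<Rightarrow> bool" where
  "weak_dual_solution s m u0 u \<longleftrightarrow>
     set_borel_measurable borel ({0..} \<times> UNIV) (\<lambda>(t, x). u t x) \<and>
     (\<forall>t\<ge>0. nonneg_ae (u t)) \<and>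
     (\<forall>T>0.
        (\<forall>x0. (\<forall>t\<in>{0..T}. u t \<in> green_space_at s x0) \<and>
              (\<forall>t0\<in>{0..T}.
                 ((\<lambda>t. green_norm_at s x0 (\<lambda>x. u t x - u t0 x)) \<longlongrightarrow> 0) (at t0 within {0..T}))) \<and>
        (\<forall>K. compact K \<longrightarrow> set_integrable lborel ({0<..<T} \<times> K) (\<lambda>(t, x). u t x powr m)) \<and>
        (\<forall>\<psi> \<psi>'. test_function T \<psi> \<psi>' \<longrightarrow>
           (LINT t:{0<..<T}|lborel. LINT x|lborel. \<psi>' t x * inv_frac_laplacian s (u t) x) =
           (LINT t:{0<..<T}|lborel. LINT x|lborel. u t x powr m * \<psi> t x))) \<and>
     (AE x in lborel. u 0 x = u0 x)"

definition approximates_from_below ::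
    "(nat \<Rightarrow> 'a::euclidean_space \<Rightarrow> real) \<Rightarrow> ('a \<Rightarrow> real) \<Rightarrow> bool" where
  "approximates_from_below f u0 \<longleftrightarrow>
     (\<forall>k. f k \<in> L1_space \<inter> Linf_space \<and> nonneg_ae (f k)) \<and>
     (AE x in lborel. incseq (\<lambda>k. f k x) \<and> (\<lambda>k. f k x) \<longlonglongrightarrow> u0 x)"

text \<open>
  The weak dual solution with datum \<open>u0\<close>: the one obtained as monotone limit of the mild solutions
  for any approximation of \<open>u0\<close> from below (the result does not depend on the approximation).
\<close>

definition the_weak_dual_solution ::
    "real \<Rightarrow> real \<Rightarrow> ('a::euclidean_space \<Rightarrow> real) \<Rightarrow> (real \<Rightarrow> 'a \<Rightarrow> real) \<Rightarrow> bool" where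
  "the_weak_dual_solution s m u0 u \<longleftrightarrow>
     weak_dual_solution s m u0 u \<and>
     (\<forall>f. approximates_from_below f u0 \<longrightarrow>
        (\<exists>U. (\<forall>k. mild_solution s m (f k) (U k)) \<and>
             (\<forall>t\<ge>0. AE x in lborel. incseq (\<lambda>k. U k t x) \<and> (\<lambda>k. U k t x) \<longlonglongrightarrow> u t x)))"


subsection \<open>Short-time smoothing estimates\<close>

definition short_time_bound ::
    "real \<Rightarrow> real \<Rightarrow> real \<Rightarrow> real \<Rightarrow> 'a::euclidean_space set \<Rightarrow> real \<Rightarrow> (real \<Rightarrow> 'a \<Rightarrow> real) \<Rightarrow> bool" where
  "short_time_bound m a b C K N u \<longleftrightarrow>
     (\<forall>t. 0 < t \<and> t \<le> N powr (- (m - 1)) \<longrightarrow>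
        Linf_norm K (u t) \<le> ennreal (C * t powr (- a) * N powr b))"

end

(*
  If v solves the equation, so does A * v (B * t) (z + L * (x - z)) with B = A^(m-1) * L^(2s). Applying
  the assumed estimate to all rescalings of the solution with datum the indicator of the unit ball
  at z, and reading it off at the rescaled image of one fixed time tau with v(tau) not null, gives
  A <= Q * B^a * (A / L^n)^b for all A > 0 and all large L. Since A is arbitrary, (m-1)a + b = 1;
  letting L tend to infinity gives 2sa >= nb. For L >= 1 the datum lives in the unit ball around z,
  where the Green norm centred at z is the L1 norm, and the uniform Green norm is comparable to it.
*)
theory Submission
  imports Defs
begin

text \<open>The estimate is read off at time \<open>\<tau> / B\<close>. With N comparable to A /
  L^n, the restriction \<open>\<tau> / B\<close> \<le> N^(-(m-1)) amounts to A^(m-1) / L^(n(m-1))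
  \<le> const * A^(m-1) * L^(2s). The amplitude cancels, so only L has to be large, while A may tend
  to 0 as well as to infinity; this is what turns the inequality for A into the equality (m-1)a + b
  = 1. All the information taken from v is that L1 continuity at time 0 keeps it from vanishing at
  once. Hence for some \<open>\<tau>\<close>, \<open>e\<close>, \<open>R\<close> the set where
  |v(\<tau>)| exceeds \<open>e\<close> has positive measure inside the ball of radius
  \<open>R\<close> about z, and rescaling with L \<ge> R carries it into the unit ball about z, the
  one compact set on which all four estimates are tested. Inserting b = 1 - (m-1)a into 2sa \<ge> nb
  gives a (n(m-1) + 2s) \<ge> n.\<close>

section \<open>Affine changes of variables in Lebesgue measure\<close>

lemma nn_integral_affine:
  fixes c :: "'a::euclidean_space"
  assumes [measurable]: "f \<in> borel_measurable borel" and L: "0 < L"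
  shows "(\<integral>\<^sup>+ x. f (c + L *\<^sub>R x) \<partial>lborel) = ennreal (1 / L ^ DIM('a)) * (\<integral>\<^sup>+ x. f x \<partial>lborel)"
proof -
  have "(\<integral>\<^sup>+ x. f x \<partial>lborel) = ennreal (L ^ DIM('a)) * (\<integral>\<^sup>+ x. f (c + L *\<^sub>R x) \<partial>lborel)"
    by (subst lborel_affine[of L c])
       (use L in \<open>simp_all add: nn_integral_density nn_integral_distr nn_integral_cmult ennreal_power\<close>)
  then show ?thesis
    using L by (simp add: mult.assoc[symmetric] ennreal_mult[symmetric])
qed

lemma lebesgue_integral_affine:
  fixes c :: "'a::euclidean_space" and f :: "'a \<Rightarrow> 'b::{banach, second_countable_topology}"
  assumes [measurable]: "f \<in> borel_measurable borel" and L: "0 < L"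
  shows "(LINT x|lborel. f (c + L *\<^sub>R x)) = (1 / L ^ DIM('a)) *\<^sub>R (LINT x|lborel. f x)"
proof -
  have "(LINT x|lborel. f x) = L ^ DIM('a) *\<^sub>R (LINT x|lborel. f (c + L *\<^sub>R x))"
    by (subst lborel_affine[of L c])
       (use L in \<open>simp_all add: integral_density integral_distr\<close>)
  then show ?thesis
    using L by simp
qed

lemma AE_lborel_affine:
  fixes c :: "'a::euclidean_space"
  assumes [measurable]: "Measurable.pred borel P" and L: "L \<noteq> 0"
  shows "(AE x in lborel. P (c + L *\<^sub>R x)) \<longleftrightarrow> (AE x in lborel. P x)"
  by (subst (2) lborel_affine[of L c])
     (use L in \<open>simp_all add: AE_density AE_distr_iff\<close>)

section \<open>L1 and Linf norms under affine maps\<close>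

lemma restrict_space_UNIV: "restrict_space (lborel :: 'a::euclidean_space measure) UNIV = lborel"
  by (rule measure_eqI) (simp_all add: emeasure_restrict_space)

lemma AE_le_Linf_norm_UNIV: "AE x in lborel. ennreal \<bar>f x\<bar> \<le> Linf_norm UNIV f"
  unfolding Linf_norm_def restrict_space_UNIV by (rule esssup_AE)

lemma Linf_space_iff:
  "f \<in> Linf_space \<longleftrightarrow> f \<in> borel_measurable borel \<and> (\<exists>B. AE x in lborel. \<bar>f x\<bar> \<le> B)"
proof safe
  assume f: "f \<in> Linf_space"
  then show "f \<in> borel_measurable borel"
    by (simp add: Linf_space_def)
  define B where "B = enn2real (Linf_norm UNIV f)"
  have "Linf_norm UNIV f = ennreal B"
    using f by (simp add: B_def Linf_space_def)
  moreover have "0 \<le> B"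
    by (simp add: B_def)
  ultimately have "AE x in lborel. \<bar>f x\<bar> \<le> B"
    using AE_le_Linf_norm_UNIV[of f] by simp
  then show "\<exists>B. AE x in lborel. \<bar>f x\<bar> \<le> B" ..
next
  fix B assume [measurable]: "f \<in> borel_measurable borel" and B: "AE x in lborel. \<bar>f x\<bar> \<le> B"
  have "Linf_norm UNIV f \<le> ennreal B"
    unfolding Linf_norm_def restrict_space_UNIV
    by (rule esssup_I) (use B in \<open>auto intro: ennreal_leI\<close>)
  then have "Linf_norm UNIV f < \<infinity>"
    by (rule le_less_trans) simp
  then show "f \<in> Linf_space"
    by (simp add: Linf_space_def)
qed

lemma L1_norm_affine:
  fixes c :: "'a::euclidean_space"
  assumes [measurable]: "f \<in> borel_measurable borel" and L: "0 < L" and A: "0 \<le> A"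
  shows "L1_norm (\<lambda>x. A * f (c + L *\<^sub>R x)) = ennreal (A / L ^ DIM('a)) * L1_norm f"
proof -
  have "L1_norm (\<lambda>x. A * f (c + L *\<^sub>R x)) = (\<integral>\<^sup>+ x. ennreal A * ennreal \<bar>f (c + L *\<^sub>R x)\<bar> \<partial>lborel)"
    using A by (simp add: L1_norm_def abs_mult ennreal_mult)
  also have "\<dots> = ennreal A * (ennreal (1 / L ^ DIM('a)) * L1_norm f)"
    unfolding L1_norm_def using L
    by (subst nn_integral_cmult) (simp_all add: nn_integral_affine[of "\<lambda>x. ennreal \<bar>f x\<bar>"])
  finally show ?thesis
    using A L by (simp add: mult.assoc[symmetric] ennreal_mult[symmetric])
qed

text \<open>The intermediate function stands first in both differences because convergence of the
  schemes is stated for scheme minus solution.\<close>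

lemma L1_norm_triangle:
  assumes [measurable]: "f \<in> borel_measurable borel" "g \<in> borel_measurable borel" "h \<in> borel_measurable borel"
  shows "L1_norm (\<lambda>x. f x - h x) \<le> L1_norm (\<lambda>x. g x - f x) + L1_norm (\<lambda>x. g x - h x)"
proof -
  have "L1_norm (\<lambda>x. f x - h x) \<le> (\<integral>\<^sup>+ x. ennreal \<bar>g x - f x\<bar> + ennreal \<bar>g x - h x\<bar> \<partial>lborel)"
    unfolding L1_norm_def
    by (intro nn_integral_mono) (auto simp: ennreal_plus[symmetric] simp del: ennreal_plus intro!: ennreal_leI)
  then show ?thesis
    unfolding L1_norm_def by (subst (asm) nn_integral_add) simp_all
qed

lemma L1_norm_eq_0_iff:
  assumes [measurable]: "f \<in> borel_measurable borel"
  shows "L1_norm f = 0 \<longleftrightarrow> null_ae f"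
  unfolding L1_norm_def null_ae_def by (subst nn_integral_0_iff_AE) simp_all

lemma L1_space_affine:
  fixes c :: "'a::euclidean_space"
  assumes f: "f \<in> L1_space" and L: "0 < L"
  shows "(\<lambda>x. A * f (c + L *\<^sub>R x)) \<in> L1_space"
proof -
  have [measurable]: "f \<in> borel_measurable borel" and fin: "L1_norm f < \<infinity>"
    using f by (auto simp: L1_space_def)
  have "L1_norm (\<lambda>x. A * f (c + L *\<^sub>R x)) = L1_norm (\<lambda>x. \<bar>A\<bar> * f (c + L *\<^sub>R x))"
    by (simp add: L1_norm_def abs_mult)
  then show ?thesis
    using fin L by (simp add: L1_space_def L1_norm_affine ennreal_mult_less_top)
qed

lemma Linf_space_affine:
  fixes c :: "'a::euclidean_space"
  assumes f: "f \<in> Linf_space" and L: "0 < L"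
  shows "(\<lambda>x. A * f (c + L *\<^sub>R x)) \<in> Linf_space"
proof -
  obtain B where B: "AE x in lborel. \<bar>f x\<bar> \<le> B" and [measurable]: "f \<in> borel_measurable borel"
    using f by (auto simp: Linf_space_iff)
  have "AE x in lborel. \<bar>f (c + L *\<^sub>R x)\<bar> \<le> B"
    using B L by (subst AE_lborel_affine[of "\<lambda>x. \<bar>f x\<bar> \<le> B"]) simp_all
  then have "AE x in lborel. \<bar>A * f (c + L *\<^sub>R x)\<bar> \<le> \<bar>A\<bar> * B"
    by eventually_elim (simp add: abs_mult mult_left_mono)
  then show ?thesis
    by (auto simp: Linf_space_iff)
qed

section \<open>Scaling covariance of the fractional Laplacian and of the Euler scheme\<close>

lemma fourier_affine:
  fixes c :: "'a::euclidean_space"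
  assumes [measurable]: "f \<in> borel_measurable borel" and L: "0 < L"
  shows "fourier (\<lambda>x. A * f (c + L *\<^sub>R x)) \<xi> =
    complex_of_real (A / L ^ DIM('a)) * cis (c \<bullet> \<xi> / L) * fourier f (\<xi> /\<^sub>R L)"
proof -
  let ?g = "\<lambda>x. complex_of_real (f x) * cis (- (x \<bullet> (\<xi> /\<^sub>R L)))"
  have "isCont cis t" for t
    unfolding cis_conv_exp by (intro continuous_intros)
  then have cis: "continuous_on UNIV cis"
    by (simp add: continuous_at_imp_continuous_on)
  have [measurable]: "cis \<in> borel_measurable borel"
    by (rule borel_measurable_continuous_onI[OF cis])
  have "fourier (\<lambda>x. A * f (c + L *\<^sub>R x)) \<xi> =
      (LINT x|lborel. (complex_of_real A * cis (c \<bullet> \<xi> / L)) * ?g (c + L *\<^sub>R x))"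
    unfolding fourier_def
  proof (rule Bochner_Integration.integral_cong[OF refl])
    fix x
    \<comment> \<open>With y = c + L x the phase is x = (y - c) / L; its constant part leaves the
      integral as a unimodular factor.\<close>
    have "cis (- (x \<bullet> \<xi>)) = cis (c \<bullet> \<xi> / L) * cis (- ((c + L *\<^sub>R x) \<bullet> (\<xi> /\<^sub>R L)))"
      using L by (simp add: cis_mult inner_add_left field_simps)
    then show "complex_of_real (A * f (c + L *\<^sub>R x)) * cis (- (x \<bullet> \<xi>)) =
        (complex_of_real A * cis (c \<bullet> \<xi> / L)) * ?g (c + L *\<^sub>R x)"
      by simp
  qed
  also have "\<dots> = (complex_of_real A * cis (c \<bullet> \<xi> / L)) * (LINT x|lborel. ?g (c + L *\<^sub>R x))"
    by (rule integral_mult_right_zero)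
  also have "(LINT x|lborel. ?g (c + L *\<^sub>R x)) = (1 / L ^ DIM('a)) *\<^sub>R (LINT x|lborel. ?g x)"
    using L by (intro lebesgue_integral_affine) simp_all
  finally show ?thesis
    by (simp add: fourier_def scaleR_conv_of_real field_simps)
qed

text \<open>The multiplier is homogeneous of degree 2s, and both transforms are evaluated at the
  dilated frequency \<open>\<xi> /\<^sub>R L\<close>, which costs \<open>L powr (2 * s)\<close>. The
  translation contributes the same phase to both sides and cancels.\<close>

lemma frac_laplacian_eq_affine:
  fixes c :: "'a::euclidean_space"
  assumes wg: "frac_laplacian_eq s w g" and L: "0 < L"
  shows "frac_laplacian_eq s (\<lambda>x. A * w (c + L *\<^sub>R x)) (\<lambda>x. (A * L powr (2 * s)) * g (c + L *\<^sub>R x))"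
proof -
  have w: "w \<in> L1_space \<inter> Linf_space" and g: "g \<in> L1_space \<inter> Linf_space"
    and eq: "\<And>\<xi>. complex_of_real (norm \<xi> powr (2 * s)) * fourier w \<xi> = fourier g \<xi>"
    using wg by (auto simp: frac_laplacian_eq_def)
  have [measurable]: "w \<in> borel_measurable borel" "g \<in> borel_measurable borel"
    using w g by (auto simp: L1_space_def)
  have "complex_of_real (norm \<xi> powr (2 * s)) * fourier (\<lambda>x. A * w (c + L *\<^sub>R x)) \<xi> =
      fourier (\<lambda>x. (A * L powr (2 * s)) * g (c + L *\<^sub>R x)) \<xi>" for \<xi>
  proof -
    have "norm \<xi> = L * norm (\<xi> /\<^sub>R L)"
      using L by simp
    then have "norm \<xi> powr (2 * s) = L powr (2 * s) * norm (\<xi> /\<^sub>R L) powr (2 * s)"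
      by (simp only: powr_mult[symmetric])
    then show ?thesis
      using L by (simp add: fourier_affine eq[symmetric] del: norm_scaleR)
  qed
  then show ?thesis
    using w g L by (simp add: frac_laplacian_eq_def L1_space_affine Linf_space_affine)
qed

text \<open>On the rescaled iterate the nonlinear term gains
  \<open>A powr m * L powr (2 * s)\<close>, the difference of two iterates only \<open>A\<close>.
  The quotient of these factors is \<open>A powr (m - 1) * L powr (2 * s)\<close>, and dividing the
  step length by it restores the equation with the same number of steps.\<close>

lemma implicit_euler_affine:
  fixes c :: "'a::euclidean_space"
  assumes v: "implicit_euler s m T l f v" and L: "0 < L" and A: "0 < A"
  shows "implicit_euler s m (T / (A powr (m - 1) * L powr (2 * s))) l
     (\<lambda>x. A * f (c + L *\<^sub>R x)) (\<lambda>j x. A * v j (c + L *\<^sub>R x))"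
  unfolding implicit_euler_def
proof (intro conjI allI impI)
  show "(\<lambda>x. A * v 0 (c + L *\<^sub>R x)) = (\<lambda>x. A * f (c + L *\<^sub>R x))"
    using v by (simp add: implicit_euler_def)
next
  fix j assume "j \<le> l"
  then have vj: "v j \<in> L1_space \<inter> Linf_space" and pos: "AE x in lborel. 0 \<le> v j x"
    using v by (auto simp: implicit_euler_def nonneg_ae_def)
  have [measurable]: "v j \<in> borel_measurable borel"
    using vj by (auto simp: L1_space_def)
  show "(\<lambda>x. A * v j (c + L *\<^sub>R x)) \<in> L1_space \<inter> Linf_space"
    using vj L by (simp add: L1_space_affine Linf_space_affine)
  have "AE x in lborel. 0 \<le> v j (c + L *\<^sub>R x)"
    using pos L by (subst AE_lborel_affine[of "\<lambda>x. 0 \<le> v j x"]) simp_all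
  then show "nonneg_ae (\<lambda>x. A * v j (c + L *\<^sub>R x))"
    using A by (simp add: nonneg_ae_def zero_le_mult_iff)
next
  fix j assume "j < l"
  then have "frac_laplacian_eq s (\<lambda>x. v (Suc j) x powr m) (\<lambda>x. (v j x - v (Suc j) x) / (T / real l))"
    using v by (auto simp: implicit_euler_def)
  from frac_laplacian_eq_affine[OF this L, of "A powr m" c]
  have "frac_laplacian_eq s (\<lambda>x. A powr m * v (Suc j) (c + L *\<^sub>R x) powr m)
    (\<lambda>x. A powr m * L powr (2 * s) * ((v j (c + L *\<^sub>R x) - v (Suc j) (c + L *\<^sub>R x)) / (T / real l)))" .
  moreover have "A powr m = A * A powr (m - 1)"
    using A by (simp add: powr_mult_base)
  ultimately show "frac_laplacian_eq s (\<lambda>x. (A * v (Suc j) (c + L *\<^sub>R x)) powr m)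
      (\<lambda>x. (A * v j (c + L *\<^sub>R x) - A * v (Suc j) (c + L *\<^sub>R x)) /
            (T / (A powr (m - 1) * L powr (2 * s)) / real l))"
    by (simp add: powr_mult algebra_simps)
qed

section \<open>Rescaled mild and weak dual solutions\<close>

lemma mild_solution_schemes:
  assumes "mild_solution s m f U" "0 < T"
  obtains V where "\<And>l. 0 < l \<Longrightarrow> implicit_euler s m T l f (V l)"
proof -
  have "\<forall>l>0. \<exists>v. implicit_euler s m T l f v"
    by (rule assms(1)[unfolded mild_solution_def, THEN conjunct2, THEN conjunct2, THEN spec, THEN mp,
          OF assms(2), THEN conjunct1])
  then have "0 < l \<Longrightarrow> implicit_euler s m T l f (SOME v. implicit_euler s m T l f v)" for l
    by (simp add: someI_ex)
  then show thesis
    by (rule that)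
qed

lemma mild_solution_convergence:
  assumes U: "mild_solution s m f U" and T: "0 < T" and V: "\<And>l. 0 < l \<Longrightarrow> implicit_euler s m T l f (V l)"
  shows "(\<lambda>l. SUP t\<in>{0..T}. L1_norm (\<lambda>x. V l (nat \<lceil>t / (T / real l)\<rceil>) x - U t x)) \<longlonglongrightarrow> 0"
proof -
  have "\<forall>V. (\<forall>l>0. implicit_euler s m T l f (V l)) \<longrightarrow>
      (\<lambda>l. SUP t\<in>{0..T}. L1_norm (\<lambda>x. V l (nat \<lceil>t / (T / real l)\<rceil>) x - U t x)) \<longlonglongrightarrow> 0"
    by (rule U[unfolded mild_solution_def, THEN conjunct2, THEN conjunct2, THEN spec, THEN mp,
          OF T, THEN conjunct2])
  then show ?thesis
    using V by blast
qed

text \<open>At t = \<open>T\<close> the interpolation index is exactly \<open>l\<close>, so this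
  difference is one of those under the supremum. Nothing is lost by looking at the last iterate
  alone: the horizon is free and is later set to the very time at which two solutions are
  compared.\<close>

lemma mild_solution_terminal_step:
  assumes U: "mild_solution s m f U" and T: "0 < T" and V: "\<And>l. 0 < l \<Longrightarrow> implicit_euler s m T l f (V l)"
  shows "(\<lambda>l. L1_norm (\<lambda>x. V l l x - U T x)) \<longlonglongrightarrow> 0"
proof (rule tendsto_sandwich[OF _ _ tendsto_const])
  show "(\<lambda>l. SUP t\<in>{0..T}. L1_norm (\<lambda>x. V l (nat \<lceil>t / (T / real l)\<rceil>) x - U t x)) \<longlonglongrightarrow> 0"
    by (rule mild_solution_convergence[OF U T V])
  show "\<forall>\<^sub>F l in sequentially. L1_norm (\<lambda>x. V l l x - U T x) \<le>
      (SUP t\<in>{0..T}. L1_norm (\<lambda>x. V l (nat \<lceil>t / (T / real l)\<rceil>) x - U t x))"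
    using eventually_gt_at_top[of 0]
  proof eventually_elim
    case (elim l)
    then have "nat \<lceil>T / (T / real l)\<rceil> = l"
      using T by simp
    then show ?case
      using SUP_upper[of T "{0..T}" "\<lambda>t. L1_norm (\<lambda>x. V l (nat \<lceil>t / (T / real l)\<rceil>) x - U t x)"] T
      by simp
  qed
qed simp

text \<open>
  Both sides are limits of the same rescaled Euler schemes, so no uniqueness theorem is needed.
\<close>

lemma mild_solution_affine:
  fixes c :: "'a::euclidean_space"
  assumes U: "mild_solution s m f U" and W: "mild_solution s m (\<lambda>x. A * f (c + L *\<^sub>R x)) W"
    and L: "0 < L" and A: "0 < A" and t: "0 < t"
  shows "AE x in lborel. W t x = A * U (A powr (m - 1) * L powr (2 * s) * t) (c + L *\<^sub>R x)"
proof -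
  define B where "B = A powr (m - 1) * L powr (2 * s)"
  have B: "0 < B"
    using A L by (simp add: B_def)
  then have Bt: "0 < B * t"
    using t by simp
  \<comment> \<open>The horizon \<open>B * t\<close> is chosen so that rescaling these schemes
    yields schemes for \<open>W\<close> with horizon \<open>t\<close>; their last iterates
    approximate both \<open>U (B * t)\<close>, after rescaling, and \<open>W t\<close>.\<close>
  obtain V where V: "\<And>l. 0 < l \<Longrightarrow> implicit_euler s m (B * t) l f (V l)"
    using mild_solution_schemes[OF U Bt] by blast
  have V': "0 < l \<Longrightarrow> implicit_euler s m t l (\<lambda>x. A * f (c + L *\<^sub>R x)) (\<lambda>j x. A * V l j (c + L *\<^sub>R x))" for l
    using implicit_euler_affine[OF V L A, folded B_def] B by simp
  have [measurable]: "U (B * t) \<in> borel_measurable borel" "W t \<in> borel_measurable borel"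
    using U W Bt t by (auto simp: mild_solution_def L1_space_def)
  have mV: "0 < l \<Longrightarrow> V l l \<in> borel_measurable borel" for l
    using V by (auto simp: implicit_euler_def L1_space_def)
  let ?S = "\<lambda>x. A * U (B * t) (c + L *\<^sub>R x)"
  have "(\<lambda>l. ennreal (A / L ^ DIM('a)) * L1_norm (\<lambda>x. V l l x - U (B * t) x)) \<longlonglongrightarrow> ennreal (A / L ^ DIM('a)) * 0"
    by (intro ennreal_tendsto_cmult mild_solution_terminal_step[OF U Bt V]) simp_all
  moreover have "(\<lambda>l. L1_norm (\<lambda>x. A * V l l (c + L *\<^sub>R x) - W t x)) \<longlonglongrightarrow> 0"
    using mild_solution_terminal_step[OF W t V'] by simp
  ultimately have lim: "(\<lambda>l. L1_norm (\<lambda>x. A * V l l (c + L *\<^sub>R x) - W t x) +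
      ennreal (A / L ^ DIM('a)) * L1_norm (\<lambda>x. V l l x - U (B * t) x)) \<longlonglongrightarrow> 0 + ennreal (A / L ^ DIM('a)) * 0"
    by (intro tendsto_add)
  have ev: "\<forall>\<^sub>F l in sequentially. L1_norm (\<lambda>x. W t x - ?S x) \<le> L1_norm (\<lambda>x. A * V l l (c + L *\<^sub>R x) - W t x) +
      ennreal (A / L ^ DIM('a)) * L1_norm (\<lambda>x. V l l x - U (B * t) x)"
    using eventually_gt_at_top[of 0]
  proof eventually_elim
    case (elim l)
    note [measurable] = mV[OF elim]
    have "ennreal (A / L ^ DIM('a)) * L1_norm (\<lambda>x. V l l x - U (B * t) x) =
        L1_norm (\<lambda>x. A * V l l (c + L *\<^sub>R x) - ?S x)"
      using L1_norm_affine[of "\<lambda>x. V l l x - U (B * t) x" L A c] L A by (simp add: right_diff_distrib)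
    then show ?case
      using L1_norm_triangle[of "W t" "\<lambda>x. A * V l l (c + L *\<^sub>R x)" ?S] by simp
  qed
  have "L1_norm (\<lambda>x. W t x - ?S x) \<le> 0 + ennreal (A / L ^ DIM('a)) * 0"
    by (rule tendsto_lowerbound[OF lim ev trivial_limit_sequentially])
  then have "L1_norm (\<lambda>x. W t x - ?S x) = 0"
    by simp
  moreover have "(\<lambda>x. W t x - ?S x) \<in> borel_measurable borel"
    by measurable
  ultimately have "null_ae (\<lambda>x. W t x - ?S x)"
    by (simp only: L1_norm_eq_0_iff)
  then show ?thesis
    by (simp add: null_ae_def B_def)
qed

lemma the_weak_dual_solution_limit:
  assumes w: "the_weak_dual_solution s m u0 w" and f: "approximates_from_below f u0" and t: "0 < t"
  obtains W where "\<And>k. mild_solution s m (f k) (W k)" "AE x in lborel. (\<lambda>k. W k t x) \<longlonglongrightarrow> w t x"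
proof -
  obtain W where W: "\<forall>k. mild_solution s m (f k) (W k)"
      "\<forall>t\<ge>0. AE x in lborel. incseq (\<lambda>k. W k t x) \<and> (\<lambda>k. W k t x) \<longlonglongrightarrow> w t x"
    using w f unfolding the_weak_dual_solution_def by blast
  from W(2) t have "AE x in lborel. incseq (\<lambda>k. W k t x) \<and> (\<lambda>k. W k t x) \<longlonglongrightarrow> w t x"
    by simp
  then have "AE x in lborel. (\<lambda>k. W k t x) \<longlonglongrightarrow> w t x"
    by eventually_elim simp
  with W(1) show thesis
    by (intro that) simp_all
qed

text \<open>A datum in L1 and Linf is approximated from below by the constant sequence. The
  definition then exhibits \<open>w\<close> as limit of mild solutions with one and the same datum,
  each of which agrees almost everywhere with the rescaled \<open>U\<close>.\<close>

lemma the_weak_dual_solution_affine: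
  fixes c :: "'a::euclidean_space"
  assumes U: "mild_solution s m f U" and w: "the_weak_dual_solution s m (\<lambda>x. A * f (c + L *\<^sub>R x)) w"
    and f: "f \<in> L1_space \<inter> Linf_space" "\<And>x. 0 \<le> f x"
    and L: "0 < L" and A: "0 < A" and t: "0 < t"
  shows "AE x in lborel. w t x = A * U (A powr (m - 1) * L powr (2 * s) * t) (c + L *\<^sub>R x)"
proof -
  let ?f = "\<lambda>x. A * f (c + L *\<^sub>R x)"
  have below: "approximates_from_below (\<lambda>k. ?f) ?f"
    using f A L by (simp add: approximates_from_below_def nonneg_ae_def L1_space_affine Linf_space_affine)
  obtain W where W: "\<And>k. mild_solution s m ?f (W k)"
    and lim: "AE x in lborel. (\<lambda>k. W k t x) \<longlonglongrightarrow> w t x"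
    using the_weak_dual_solution_limit[OF w below t] by blast
  \<comment> \<open>The exceptional null set may vary with \<open>k\<close>; countably many are
    merged.\<close>
  have "AE x in lborel. \<forall>k. W k t x = A * U (A powr (m - 1) * L powr (2 * s) * t) (c + L *\<^sub>R x)"
    using mild_solution_affine[OF U W L A t] by (subst AE_all_countable) auto
  with lim show ?thesis
    by eventually_elim (simp add: LIMSEQ_const_iff)
qed

section \<open>Nontriviality at a positive time\<close>

text \<open>The initial value is encoded in \<open>mild_solution\<close> only through the schemes,
  so \<open>U 0 = f\<close> almost everywhere is recovered first; L1 continuity at 0 then gives the
  claim for small times. The horizon 1 is arbitrary.\<close>

lemma mild_solution_eventually_not_null:
  assumes U: "mild_solution s m f U" and f: "f \<in> L1_space" "\<not> null_ae f"
  obtains \<tau> where "0 < \<tau>" "\<not> null_ae (U \<tau>)"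
proof -
  have meas: "0 \<le> t \<Longrightarrow> U t \<in> borel_measurable borel" for t
    using U by (auto simp: mild_solution_def L1_space_def)
  have [measurable]: "U 0 \<in> borel_measurable borel" "f \<in> borel_measurable borel"
    using meas f by (auto simp: L1_space_def)
  obtain V where V: "\<And>l. 0 < l \<Longrightarrow> implicit_euler s m 1 l f (V l)"
    using mild_solution_schemes[OF U zero_less_one] by blast
  have V0: "0 < l \<Longrightarrow> V l 0 = f" for l
    using V by (simp add: implicit_euler_def)
  have lim: "(\<lambda>l. SUP t\<in>{0..1}. L1_norm (\<lambda>x. V l (nat \<lceil>t / (1 / real l)\<rceil>) x - U t x)) \<longlonglongrightarrow> 0"
    by (rule mild_solution_convergence[OF U zero_less_one V])
  \<comment> \<open>At t = 0 the interpolation index is 0, where every scheme equals its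
    datum.\<close>
  have ev: "\<forall>\<^sub>F l in sequentially. L1_norm (\<lambda>x. f x - U 0 x) \<le>
      (SUP t\<in>{0..1}. L1_norm (\<lambda>x. V l (nat \<lceil>t / (1 / real l)\<rceil>) x - U t x))"
    using eventually_gt_at_top[of 0]
  proof eventually_elim
    case (elim l)
    show ?case
      using SUP_upper[of 0 "{0..1}" "\<lambda>t. L1_norm (\<lambda>x. V l (nat \<lceil>t / (1 / real l)\<rceil>) x - U t x)"]
      by (simp add: V0[OF elim])
  qed
  have "L1_norm (\<lambda>x. f x - U 0 x) \<le> 0"
    by (rule tendsto_lowerbound[OF lim ev trivial_limit_sequentially])
  then have eq: "AE x in lborel. f x = U 0 x"
    using L1_norm_eq_0_iff[of "\<lambda>x. f x - U 0 x"] by (simp add: null_ae_def)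
  have "\<not> null_ae (U 0)"
  proof
    assume "null_ae (U 0)"
    then have "null_ae f"
      using eq unfolding null_ae_def by eventually_elim simp
    with f show False by simp
  qed
  then have "0 < L1_norm (U 0)"
    by (simp add: L1_norm_eq_0_iff zero_less_iff_neq_zero)
  moreover have "((\<lambda>t. L1_norm (\<lambda>x. U t x - U 0 x)) \<longlongrightarrow> 0) (at 0 within {0..})"
    using U[unfolded mild_solution_def, THEN conjunct2, THEN conjunct1] by simp
  then have "((\<lambda>t. L1_norm (\<lambda>x. U t x - U 0 x)) \<longlongrightarrow> 0) (at_right 0)"
    by (simp only: at_within_Ici_at_right)
  ultimately have "\<forall>\<^sub>F t in at_right 0. L1_norm (\<lambda>x. U t x - U 0 x) < L1_norm (U 0)"
    by (intro order_tendstoD(2))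
  then obtain d where d: "0 < d" "\<And>t. 0 < t \<Longrightarrow> t < d \<Longrightarrow> L1_norm (\<lambda>x. U t x - U 0 x) < L1_norm (U 0)"
    unfolding eventually_at_right_field by blast
  define \<tau> where "\<tau> = d / 2"
  have \<tau>: "0 < \<tau>" "L1_norm (\<lambda>x. U \<tau> x - U 0 x) < L1_norm (U 0)"
    using d by (auto simp: \<tau>_def)
  \<comment> \<open>A null \<open>U \<tau>\<close> would be at distance exactly
    \<open>L1_norm (U 0)\<close> from \<open>U 0\<close>.\<close>
  have "\<not> null_ae (U \<tau>)"
  proof
    assume "null_ae (U \<tau>)"
    then have "AE x in lborel. ennreal \<bar>U \<tau> x - U 0 x\<bar> = ennreal \<bar>U 0 x\<bar>"
      unfolding null_ae_def by eventually_elim simp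
    then have "L1_norm (\<lambda>x. U \<tau> x - U 0 x) = L1_norm (U 0)"
      unfolding L1_norm_def by (rule nn_integral_cong_AE)
    with \<tau> show False by simp
  qed
  with \<tau> show thesis
    by (intro that)
qed

text \<open>Otherwise the bound holds for all pairs \<open>e\<close> = 1/(k+1), \<open>R\<close> = k
  simultaneously, off one null set; every point lies in all but finitely many of these balls, so
  \<open>f\<close> vanishes there. Boundedness of the ball is what lets a dilation bring it into the
  unit ball.\<close>

lemma not_null_ae_lower_bound:
  fixes z :: "'a::euclidean_space"
  assumes "\<not> null_ae f"
  obtains e R where "0 < e" "\<not> (AE x in lborel. x \<in> cball z R \<longrightarrow> \<bar>f x\<bar> \<le> e)"
proof (rule ccontr)
  assume *: "\<not> thesis"
  have "AE x in lborel. x \<in> cball z (real k) \<longrightarrow> \<bar>f x\<bar> \<le> 1 / real (Suc k)" for k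
    using * that[of "1 / real (Suc k)" "real k"] by auto
  then have "AE x in lborel. \<forall>k. x \<in> cball z (real k) \<longrightarrow> \<bar>f x\<bar> \<le> 1 / real (Suc k)"
    by (subst AE_all_countable) auto
  then have "AE x in lborel. f x = 0"
  proof eventually_elim
    case (elim x)
    obtain N where N: "dist z x \<le> real N"
      using real_arch_simple by blast
    have "\<forall>\<^sub>F k in sequentially. \<bar>f x\<bar> \<le> 1 / real (Suc k)"
      using eventually_ge_at_top[of N] by eventually_elim (use elim N in force)
    moreover have "(\<lambda>k. 1 / real (Suc k)) \<longlonglongrightarrow> 0"
      using LIMSEQ_inverse_real_of_nat by (simp add: inverse_eq_divide)
    ultimately have "\<bar>f x\<bar> \<le> 0"
      using tendsto_lowerbound by (metis trivial_limit_sequentially)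
    then show ?case by simp
  qed
  with assms show False
    by (simp add: null_ae_def)
qed

section \<open>Green function off the diagonal and comparison of Green norms\<close>

text \<open>Two bounds for the two ends of the time integral: for small times the Gaussian factor
  absorbs the singular power of t, for large times the power itself decays.\<close>

lemma heat_kernel_far_bound:
  fixes x y :: "'a::euclidean_space"
  assumes xy: "1 \<le> norm (x - y)" and t: "0 < t"
  defines "p \<equiv> real DIM('a) / 2"
  shows "heat_kernel t x y \<le> (p / pi) powr p" "heat_kernel t x y \<le> t powr (- p)"
proof -
  have p: "0 < p"
    by (simp add: p_def)
  have k: "heat_kernel t x y = (4 * pi * t) powr (- p) * exp (- (norm (x - y))\<^sup>2 / (4 * t))"
    by (simp add: heat_kernel_def p_def)
  \<comment> \<open>The inequality y \<le> exp y, raised to the power \<open>p\<close>, with y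
    chosen so that the right side becomes exp(1/(4t)) and the powers of t cancel below.\<close>
  have "1 / (4 * t) / p \<le> exp (1 / (4 * t) / p)"
    using exp_ge_add_one_self[of "1 / (4 * t) / p"] by linarith
  then have "(1 / (4 * t) / p) powr p \<le> exp (1 / (4 * t) / p) powr p"
    using p t by (intro powr_mono2) auto
  also have "\<dots> = exp (1 / (4 * t))"
    using p by (simp add: exp_powr_real)
  finally have q: "exp (- (1 / (4 * t))) \<le> (4 * t * p) powr p"
    using p t by (simp add: exp_minus powr_divide powr_mult field_simps)
  have "1 \<le> (norm (x - y))\<^sup>2"
    using xy by simp
  then have e: "exp (- (norm (x - y))\<^sup>2 / (4 * t)) \<le> exp (- (1 / (4 * t)))"
    using t by (simp add: divide_right_mono)
  have "heat_kernel t x y \<le> (4 * pi * t) powr (- p) * (4 * t * p) powr p"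
    unfolding k by (intro mult_left_mono order_trans[OF e q]) auto
  also have "\<dots> = (p / pi) powr p"
    using t p by (simp add: powr_minus powr_mult powr_divide field_simps)
  finally show "heat_kernel t x y \<le> (p / pi) powr p" .
  have "1 * t \<le> (4 * pi) * t"
    using pi_gt3 t by (intro mult_right_mono) auto
  then have "(4 * pi * t) powr (- p) \<le> t powr (- p)"
    using t p by (intro powr_mono2') auto
  then have "heat_kernel t x y \<le> t powr (- p) * 1"
    unfolding k using t by (intro mult_mono) auto
  then show "heat_kernel t x y \<le> t powr (- p)" by simp
qed

lemma green_far_bound:
  assumes s: "0 < s" and dim: "2 * s < real DIM('a::euclidean_space)"
  obtains c where "0 \<le> c" "\<And>x y :: 'a. 1 \<le> norm (x - y) \<Longrightarrow> green s x y \<le> c"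
proof -
  define p where "p = real DIM('a) / 2"
  have sp: "s < p"
    using dim by (simp add: p_def)
  \<comment> \<open>A majorant independent of x and y. The first piece is integrable since s > 0,
    the second since s < \<open>p\<close>, that is 2s < n. Both pieces count at t = 1, which only
    enlarges the bound.\<close>
  define h where "h t = (p / pi) powr p * (indicator {0<..1} t *\<^sub>R t powr (s - 1)) +
     indicator {1..} t *\<^sub>R t powr (s - 1 - p)" for t :: real
  have "(\<lambda>t. t powr (s - 1)) absolutely_integrable_on {0<..1}"
    using s by (intro nonnegative_absolutely_integrable_1 integrable_on_powr_from_0') auto
  then have i1: "integrable lborel (\<lambda>t. indicator {0<..1} t *\<^sub>R t powr (s - 1))"
    unfolding set_integrable_def by (subst (asm) integrable_completion) simp_all
  have "(\<lambda>t. t powr (s - 1 - p)) absolutely_integrable_on {1..}"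
    using sp has_integral_powr_to_inf[of "s - 1 - p" 1]
    by (intro nonnegative_absolutely_integrable_1) (auto simp: integrable_on_def)
  then have i2: "integrable lborel (\<lambda>t. indicator {1..} t *\<^sub>R t powr (s - 1 - p))"
    unfolding set_integrable_def by (subst (asm) integrable_completion) simp_all
  have h: "integrable lborel h"
    unfolding h_def by (rule Bochner_Integration.integrable_add[OF integrable_mult_right[OF i1] i2])
  have hpos: "0 \<le> h t" for t
    by (simp add: h_def)
  have le: "indicator {0<..} t *\<^sub>R (heat_kernel t x y * t powr (s - 1)) \<le> h t"
    if "1 \<le> norm (x - y)" for x y :: 'a and t
  proof (cases "0 < t")
    case True
    show ?thesis
    proof (cases "t \<le> 1")
      case le1: True
      have "heat_kernel t x y * t powr (s - 1) \<le> (p / pi) powr p * t powr (s - 1)"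
        using heat_kernel_far_bound(1)[OF that True] by (intro mult_right_mono) (auto simp: p_def)
      also have "\<dots> \<le> h t"
        using True le1 by (simp add: h_def)
      finally show ?thesis
        using True by simp
    next
      case False
      have "heat_kernel t x y * t powr (s - 1) \<le> t powr (- p) * t powr (s - 1)"
        using heat_kernel_far_bound(2)[OF that True] by (intro mult_right_mono) (auto simp: p_def)
      also have "\<dots> = h t"
        using True False by (simp add: h_def powr_add[symmetric])
      finally show ?thesis
        using True by simp
    qed
  qed (use hpos in simp)
  show thesis
  proof (rule that[of "1 / Gamma s * (LINT t|lborel. h t)"])
    show "0 \<le> 1 / Gamma s * (LINT t|lborel. h t)"
      using hpos s by (simp add: Gamma_real_pos less_imp_le)
    show "green s x y \<le> 1 / Gamma s * (LINT t|lborel. h t)" if "1 \<le> norm (x - y)" for x y :: 'a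
      unfolding green_def set_lebesgue_integral_def
      using le[OF that] hpos s
      by (intro mult_left_mono integral_mono'[OF h]) (auto simp: Gamma_real_pos less_imp_le)
  qed
qed

text \<open>The weight is 1 in the unit ball and at most \<open>c\<close> outside. Since
  \<open>c\<close> is fixed before the centre \<open>z\<close>, the bound survives the supremum over
  centres and so controls the uniform Green norm.\<close>

lemma green_norm_at_le:
  assumes s: "0 < s" and dim: "2 * s < real DIM('a::euclidean_space)"
  obtains c where "0 \<le> c" "\<And>(f :: 'a \<Rightarrow> real) z. f \<in> borel_measurable borel \<Longrightarrow>
     green_norm_at s z f \<le> ennreal (1 + c) * L1_norm f"
proof -
  obtain c where c: "0 \<le> c" "\<And>x y :: 'a. 1 \<le> norm (x - y) \<Longrightarrow> green s x y \<le> c"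
    using green_far_bound[OF s dim] by blast
  show thesis
  proof (rule that[OF c(1)])
    fix f :: "'a \<Rightarrow> real" and z assume [measurable]: "f \<in> borel_measurable borel"
    have "(\<integral>\<^sup>+ x\<in>ball z 1. ennreal \<bar>f x\<bar> \<partial>lborel) \<le> L1_norm f"
      unfolding L1_norm_def by (intro nn_integral_mono) (auto simp: indicator_def)
    moreover have "(\<integral>\<^sup>+ x\<in>- ball z 1. ennreal (\<bar>f x\<bar> * green s x z) \<partial>lborel) \<le>
        (\<integral>\<^sup>+ x. ennreal c * ennreal \<bar>f x\<bar> \<partial>lborel)"
    proof (rule nn_integral_mono)
      fix x
      show "ennreal (\<bar>f x\<bar> * green s x z) * indicator (- ball z 1) x \<le> ennreal c * ennreal \<bar>f x\<bar>"
      proof (cases "x \<in> ball z 1")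
        case False
        then have "\<bar>f x\<bar> * green s x z \<le> \<bar>f x\<bar> * c"
          by (intro mult_left_mono c) (auto simp: dist_norm norm_minus_commute)
        with False show ?thesis
          using c(1) by (simp add: ennreal_mult[symmetric] ennreal_leI mult.commute)
      qed simp
    qed
    moreover have "(\<integral>\<^sup>+ x. ennreal c * ennreal \<bar>f x\<bar> \<partial>lborel) = ennreal c * L1_norm f"
      unfolding L1_norm_def by (subst nn_integral_cmult) simp_all
    ultimately have "green_norm_at s z f \<le> L1_norm f + ennreal c * L1_norm f"
      unfolding green_norm_at_def by (intro add_mono) simp_all
    also have "\<dots> = ennreal (1 + c) * L1_norm f"
      using c(1) by (simp add: distrib_right)
    finally show "green_norm_at s z f \<le> ennreal (1 + c) * L1_norm f" .
  qed
qed

lemma green_norm_at_eq_L1_norm: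
  assumes "\<And>x. x \<notin> ball z 1 \<Longrightarrow> f x = 0"
  shows "green_norm_at s z f = L1_norm f"
proof -
  have "ennreal \<bar>f x\<bar> * indicator (ball z 1) x = ennreal \<bar>f x\<bar>"
    and "ennreal (\<bar>f x\<bar> * green s x z) * indicator (- ball z 1) x = 0" for x
    using assms by (auto simp: indicator_def)
  then show ?thesis
    by (simp only: green_norm_at_def L1_norm_def nn_integral_0_iff_AE nn_integral_const) simp
qed

section \<open>Restricting essential bounds to a ball\<close>

lemma Linf_norm_leD:
  assumes K: "K \<in> sets borel" and le: "Linf_norm K f \<le> ennreal B" and B: "0 \<le> B"
  shows "AE x in lborel. x \<in> K \<longrightarrow> \<bar>f x\<bar> \<le> B"
proof -
  have "AE x in restrict_space lborel K. ennreal \<bar>f x\<bar> \<le> Linf_norm K f"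
    unfolding Linf_norm_def by (rule esssup_AE)
  then have "AE x in restrict_space lborel K. \<bar>f x\<bar> \<le> B"
    using le B by (auto elim!: eventually_mono dest: order_trans)
  then show ?thesis
    using K by (subst (asm) AE_restrict_space_iff) simp_all
qed

text \<open>Reduces the two estimates on the whole space to estimates on one compact ball.\<close>

lemma short_time_bound_mono:
  assumes K: "K \<in> sets borel" and "short_time_bound m a b C UNIV N u"
    and "\<And>t. 0 < t \<Longrightarrow> u t \<in> borel_measurable borel"
  shows "short_time_bound m a b C K N u"
proof -
  have "Linf_norm K (u t) \<le> Linf_norm UNIV (u t)" if "0 < t" for t
  proof -
    have [measurable]: "u t \<in> borel_measurable borel"
      using assms that by simp
    have *: "AE x in restrict_space lborel K. ennreal \<bar>u t x\<bar> \<le> Linf_norm UNIV (u t)"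
      using K AE_le_Linf_norm_UNIV[of "u t"] by (subst AE_restrict_space_iff) (auto elim!: eventually_mono)
    have meas: "(\<lambda>x. ennreal \<bar>u t x\<bar>) \<in> borel_measurable (restrict_space lborel K)"
      by (intro measurable_restrict_space1) simp
    show ?thesis
      by (subst Linf_norm_def) (rule esssup_I[OF meas *])
  qed
  then show ?thesis
    using assms(2) unfolding short_time_bound_def by (meson order_trans)
qed

section \<open>From the scaling inequality to the exponents\<close>

text \<open>With p = ln A and q = ln L the hypothesis becomes affine in (p, q), for all real p and
  all q \<ge> ln L0. An affine function bounded above on the whole line has slope 0, which settles
  p; one bounded below on a half-line has slope at least 0, which settles q.\<close>

lemma exponents_from_scaling:
  fixes d s m a b Q L0 :: real
  assumes s: "0 < s" and d: "0 < d" and m: "1 < m" and Q: "0 < Q" and L0: "0 < L0"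
    and bound: "\<And>A L. 0 < A \<Longrightarrow> L0 \<le> L \<Longrightarrow>
      A \<le> Q * (A powr (m - 1) * L powr (2 * s)) powr a * (A / L powr d) powr b"
  shows "d / (d * (m - 1) + 2 * s) \<le> a \<and>
    (a = d / (d * (m - 1) + 2 * s) \<longrightarrow> b = 2 * s / (d * (m - 1) + 2 * s))"
proof -
  have key: "p \<le> ln Q + a * ((m - 1) * p + 2 * s * q) + b * (p - d * q)" if "ln L0 \<le> q" for p q
  proof -
    have "L0 \<le> exp q"
      using that L0 by (simp add: ln_le_cancel_iff[symmetric] del: ln_le_cancel_iff)
    from bound[OF exp_gt_zero this, of p]
    have "exp p \<le> Q * (exp p powr (m - 1) * exp q powr (2 * s)) powr a * (exp p / exp q powr d) powr b" .
    also have "\<dots> = exp (ln Q + a * ((m - 1) * p + 2 * s * q) + b * (p - d * q))"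
    proof -
      have "(exp p powr (m - 1) * exp q powr (2 * s)) powr a = exp (a * ((m - 1) * p + 2 * s * q))"
        by (simp only: exp_powr_real exp_add[symmetric]) (simp add: algebra_simps)
      moreover have "(exp p / exp q powr d) powr b = exp (b * (p - d * q))"
        by (simp only: exp_powr_real exp_diff[symmetric]) (simp add: algebra_simps)
      ultimately show ?thesis
        using Q by (simp add: exp_add)
    qed
    finally show ?thesis by simp
  qed
  define k where "k = 1 - (m - 1) * a - b"
  have key': "k * p \<le> ln Q + (2 * s * a - d * b) * q" if "ln L0 \<le> q" for p q
    using key[OF that, of p] by (simp add: k_def algebra_simps)
  have k: "k = 0"
  proof (rule ccontr)
    assume "k \<noteq> 0"
    then show False
      \<comment> \<open>This p makes the left side exceed the right side by 1 at q = ln L0.\<close>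
      using key'[OF order_refl, of "(ln Q + (2 * s * a - d * b) * ln L0 + 1) / k"] by simp
  qed
  have "0 \<le> 2 * s * a - d * b"
  proof (rule ccontr)
    define r where "r = 2 * s * a - d * b"
    assume "\<not> 0 \<le> 2 * s * a - d * b"
    then have r: "r < 0" by (simp add: r_def)
    \<comment> \<open>The second entry pushes \<open>ln Q + r * q\<close> down to at most -1,
      against the case p = 0.\<close>
    define q where "q = max (ln L0) ((- ln Q - 1) / r)"
    have "0 \<le> ln Q + r * q"
      using key'[of q 0] by (simp add: q_def r_def)
    moreover have "(- ln Q - 1) / r \<le> q"
      by (simp add: q_def)
    then have "r * q \<le> - ln Q - 1"
      using r by (simp add: field_simps)
    ultimately show False by linarith
  qed
  moreover have b: "b = 1 - (m - 1) * a"
    using k by (simp add: k_def)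
  ultimately have "d \<le> a * (d * (m - 1) + 2 * s)"
    by (simp add: algebra_simps)
  moreover have pos: "0 < d * (m - 1) + 2 * s"
    using d m s by (simp add: add_pos_pos)
  ultimately have "d / (d * (m - 1) + 2 * s) \<le> a"
    by (simp add: pos_divide_le_eq)
  moreover have "b = 2 * s / (d * (m - 1) + 2 * s)" if "a = d / (d * (m - 1) + 2 * s)"
    using pos unfolding b that by (simp add: field_simps)
  ultimately show ?thesis by blast
qed

section \<open>Testing the estimates on rescaled indicators\<close>

theorem proposition3p13:
  fixes s m a b \<alpha> \<beta> :: real
    and z :: "'a::euclidean_space"
    and u :: "('a \<Rightarrow> real) \<Rightarrow> real \<Rightarrow> 'a \<Rightarrow> real"
  assumes s: "0 < s" "s \<le> 1"
    and m: "1 < m"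
    and dim: "2 * s < real DIM('a)"
    and alpha: "\<alpha> = real DIM('a) / (real DIM('a) * (m - 1) + 2 * s)"
    and beta: "\<beta> = 2 * s / (real DIM('a) * (m - 1) + 2 * s)"
    and u: "\<And>u0. u0 \<in> L1_space \<union> green_space_at s z \<union> green_space s \<Longrightarrow> nonneg_ae u0 \<Longrightarrow>
              the_weak_dual_solution s m u0 (u u0)"
    and estimate:
      "(\<forall>K. compact K \<and> K \<noteq> {} \<longrightarrow> (\<exists>C>0. \<forall>u0\<in>L1_space. nonneg_ae u0 \<and> \<not> null_ae u0 \<longrightarrow>
           short_time_bound m a b C K (enn2real (L1_norm u0)) (u u0))) \<or>
       (\<forall>K. compact K \<and> K \<noteq> {} \<longrightarrow> (\<exists>C>0. \<forall>u0\<in>green_space_at s z. nonneg_ae u0 \<and> \<not> null_ae u0 \<longrightarrow>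
           short_time_bound m a b C K (enn2real (green_norm_at s z u0)) (u u0))) \<or>
       (\<exists>C>0. \<forall>u0\<in>L1_space. nonneg_ae u0 \<and> \<not> null_ae u0 \<longrightarrow>
           short_time_bound m a b C UNIV (enn2real (L1_norm u0)) (u u0)) \<or>
       (\<exists>C>0. \<forall>u0\<in>green_space s. nonneg_ae u0 \<and> \<not> null_ae u0 \<longrightarrow>
           short_time_bound m a b C UNIV (enn2real (green_norm s u0)) (u u0))"
  shows "\<alpha> \<le> a \<and> (a = \<alpha> \<longrightarrow> b = \<beta>)"
proof -
  define d where "d = real DIM('a)"
  define M where "M = measure lborel (ball z 1)"
  define f :: "'a \<Rightarrow> real" where "f = indicator (ball z 1)"
  \<comment> \<open>The dilation about \<open>z\<close>, which fixes \<open>z\<close>, in the form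
    \<open>c + L *\<^sub>R x\<close> of the affine lemmas; \<open>g A L\<close> is \<open>A\<close>
    times the indicator of the ball of radius 1/L about \<open>z\<close>.\<close>
  define g where "g A L = (\<lambda>x. A * f ((z - L *\<^sub>R z) + L *\<^sub>R x))" for A L :: real
  have d: "0 < d"
    by (simp add: d_def)
  have M: "0 < M"
    unfolding M_def by (rule content_ball_pos) simp
  have f_meas [measurable]: "f \<in> borel_measurable borel"
    unfolding f_def by (intro borel_measurable_indicator borel_open open_ball)
  have f_norm: "L1_norm f = ennreal M"
  proof -
    have "L1_norm f = (\<integral>\<^sup>+ x. indicator (ball z 1) x \<partial>lborel)"
      unfolding L1_norm_def f_def by (intro nn_integral_cong) (simp add: indicator_def)
    also have "\<dots> = emeasure lborel (ball z 1)"
      by simp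
    also have "\<dots> = ennreal M"
      unfolding M_def by (rule emeasure_eq_ennreal_measure) (use emeasure_lborel_ball_finite[of z 1] in auto)
    finally show ?thesis .
  qed
  have f_pos: "0 \<le> f x" for x
    by (simp add: f_def)
  have "\<bar>f x\<bar> \<le> 1" for x
    by (simp add: f_def indicator_def)
  then have "AE x in lborel. \<bar>f x\<bar> \<le> 1"
    by simp
  then have f_space: "f \<in> L1_space \<inter> Linf_space"
    by (auto simp: L1_space_def f_norm Linf_space_iff)
  have f_not_null: "\<not> null_ae f"
    using f_norm M L1_norm_eq_0_iff[of f] by simp

  have g_space: "g A L \<in> L1_space" "g A L \<in> green_space_at s z" "g A L \<in> green_space s"
    and g_pos: "nonneg_ae (g A L)" and g_not_null: "\<not> null_ae (g A L)"
    and g_norm: "L1_norm (g A L) = ennreal (M * (A / L powr d))"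
    and g_norm_at: "green_norm_at s z (g A L) = L1_norm (g A L)"
    if "0 < A" "1 \<le> L" for A L
  proof -
    have L: "0 < L" using that by simp
    have [measurable]: "g A L \<in> borel_measurable borel"
      by (simp add: g_def)
    show gL1: "g A L \<in> L1_space"
      unfolding g_def using f_space L by (intro L1_space_affine) auto
    show norm: "L1_norm (g A L) = ennreal (M * (A / L powr d))"
      unfolding g_def using that L M
      by (simp add: L1_norm_affine f_norm ennreal_mult[symmetric] d_def powr_realpow mult.commute)
    show "nonneg_ae (g A L)"
      using that f_pos by (simp add: nonneg_ae_def g_def)
    have "L1_norm (g A L) \<noteq> 0"
      using M that by (simp add: norm)
    then show "\<not> null_ae (g A L)"
      by (simp add: L1_norm_eq_0_iff)
    have "g A L x = 0" if "x \<notin> ball z 1" for x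
    proof -
      have "dist z ((z - L *\<^sub>R z) + L *\<^sub>R x) = norm (L *\<^sub>R (z - x))"
        by (simp add: dist_norm algebra_simps)
      also have "\<dots> = L * dist z x"
        using L by (simp add: dist_norm)
      also have "\<dots> \<ge> 1 * 1"
        using \<open>1 \<le> L\<close> that by (intro mult_mono) auto
      finally show ?thesis
        by (simp add: g_def f_def)
    qed
    then show at: "green_norm_at s z (g A L) = L1_norm (g A L)"
      by (rule green_norm_at_eq_L1_norm)
    then show "g A L \<in> green_space_at s z"
      by (simp add: green_space_at_def norm)
    obtain k where k: "0 \<le> k" "\<And>(f :: 'a \<Rightarrow> real) z. f \<in> borel_measurable borel \<Longrightarrow>
        green_norm_at s z f \<le> ennreal (1 + k) * L1_norm f"
      using green_norm_at_le[OF s(1) dim] by blast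
    have "green_norm s (g A L) \<le> ennreal (1 + k) * L1_norm (g A L)"
      unfolding green_norm_def by (rule SUP_least, rule k(2)) simp
    also have "\<dots> < \<infinity>"
      by (simp add: norm ennreal_mult_less_top del: ennreal_plus)
    finally show "g A L \<in> green_space s"
      by (simp add: green_space_def)
  qed

  have sol: "the_weak_dual_solution s m (g A L) (u (g A L))" if "0 < A" "1 \<le> L" for A L
    using u g_space[OF that] g_pos[OF that] by blast
  have cball: "cball z 1 \<in> sets borel" "compact (cball z 1)" "cball z 1 \<noteq> {}"
    by auto
  have u_meas: "u (g A L) t \<in> borel_measurable borel" if "0 < A" "1 \<le> L" "0 < t" for A L t
  proof -
    have "u (g A L) t \<in> green_space_at s z"
      using sol[OF that(1,2)] that(3) unfolding the_weak_dual_solution_def weak_dual_solution_def by force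
    then show ?thesis
      by (simp add: green_space_at_def)
  qed

  \<comment> \<open>One statement for all four alternatives: \<open>N\<close> is the norm in the
    estimate and lies between the L1 norm of the datum and \<open>D\<close> times it, with
    \<open>D = 1\<close> except for the uniform Green norm. Both sides matter: the time window needs
    the upper bound, and the sign of \<open>b\<close> is unknown.\<close>
  obtain C D where C: "0 < C" and D: "1 \<le> D"
    and bound: "\<And>A L. 0 < A \<Longrightarrow> 1 \<le> L \<Longrightarrow> \<exists>N. M * (A / L powr d) \<le> N \<and> N \<le> D * (M * (A / L powr d)) \<and>
      short_time_bound m a b C (cball z 1) N (u (g A L))"
    using estimate
  proof (elim disjE)
    assume "\<forall>K. compact K \<and> K \<noteq> {} \<longrightarrow> (\<exists>C>0. \<forall>u0\<in>L1_space. nonneg_ae u0 \<and> \<not> null_ae u0 \<longrightarrow>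
        short_time_bound m a b C K (enn2real (L1_norm u0)) (u u0))"
    then obtain C where "C > 0" and C: "\<forall>u0\<in>L1_space. nonneg_ae u0 \<and> \<not> null_ae u0 \<longrightarrow>
        short_time_bound m a b C (cball z 1) (enn2real (L1_norm u0)) (u u0)"
      using cball by blast
    have "short_time_bound m a b C (cball z 1) (M * (A / L powr d)) (u (g A L))" if "0 < A" "1 \<le> L" for A L
    proof -
      have "enn2real (L1_norm (g A L)) = M * (A / L powr d)"
        unfolding g_norm[OF that] using M that by (intro enn2real_ennreal) auto
      then show ?thesis
        using C g_space[OF that] g_pos[OF that] g_not_null[OF that] by metis
    qed
    with \<open>C > 0\<close> show thesis
      by (intro that[of C 1]) auto
  next
    assume "\<forall>K. compact K \<and> K \<noteq> {} \<longrightarrow> (\<exists>C>0. \<forall>u0\<in>green_space_at s z. nonneg_ae u0 \<and> \<not> null_ae u0 \<longrightarrow>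
        short_time_bound m a b C K (enn2real (green_norm_at s z u0)) (u u0))"
    then obtain C where "C > 0" and C: "\<forall>u0\<in>green_space_at s z. nonneg_ae u0 \<and> \<not> null_ae u0 \<longrightarrow>
        short_time_bound m a b C (cball z 1) (enn2real (green_norm_at s z u0)) (u u0)"
      using cball by blast
    have "short_time_bound m a b C (cball z 1) (M * (A / L powr d)) (u (g A L))" if "0 < A" "1 \<le> L" for A L
    proof -
      have "enn2real (green_norm_at s z (g A L)) = M * (A / L powr d)"
        unfolding g_norm_at[OF that] g_norm[OF that] using M that by (intro enn2real_ennreal) auto
      then show ?thesis
        using C g_space[OF that] g_pos[OF that] g_not_null[OF that] by metis
    qed
    with \<open>C > 0\<close> show thesis
      by (intro that[of C 1]) auto
  next
    assume "\<exists>C>0. \<forall>u0\<in>L1_space. nonneg_ae u0 \<and> \<not> null_ae u0 \<longrightarrow>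
        short_time_bound m a b C UNIV (enn2real (L1_norm u0)) (u u0)"
    then obtain C where "C > 0" and C: "\<forall>u0\<in>L1_space. nonneg_ae u0 \<and> \<not> null_ae u0 \<longrightarrow>
        short_time_bound m a b C UNIV (enn2real (L1_norm u0)) (u u0)"
      by blast
    have "short_time_bound m a b C (cball z 1) (M * (A / L powr d)) (u (g A L))" if "0 < A" "1 \<le> L" for A L
    proof (rule short_time_bound_mono[OF cball(1)])
      have "enn2real (L1_norm (g A L)) = M * (A / L powr d)"
        unfolding g_norm[OF that] using M that by (intro enn2real_ennreal) auto
      then show "short_time_bound m a b C UNIV (M * (A / L powr d)) (u (g A L))"
        using C g_space[OF that] g_pos[OF that] g_not_null[OF that] by metis
    qed (rule u_meas[OF that])
    with \<open>C > 0\<close> show thesis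
      by (intro that[of C 1]) auto
  next
    assume "\<exists>C>0. \<forall>u0\<in>green_space s. nonneg_ae u0 \<and> \<not> null_ae u0 \<longrightarrow>
        short_time_bound m a b C UNIV (enn2real (green_norm s u0)) (u u0)"
    then obtain C where "C > 0" and C: "\<forall>u0\<in>green_space s. nonneg_ae u0 \<and> \<not> null_ae u0 \<longrightarrow>
        short_time_bound m a b C UNIV (enn2real (green_norm s u0)) (u u0)"
      by blast
    obtain k where k: "0 \<le> k" "\<And>(f :: 'a \<Rightarrow> real) z. f \<in> borel_measurable borel \<Longrightarrow>
        green_norm_at s z f \<le> ennreal (1 + k) * L1_norm f"
      using green_norm_at_le[OF s(1) dim] by blast
    have "\<exists>N. M * (A / L powr d) \<le> N \<and> N \<le> (1 + k) * (M * (A / L powr d)) \<and>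
        short_time_bound m a b C (cball z 1) N (u (g A L))" if "0 < A" "1 \<le> L" for A L
    proof (intro exI conjI)
      let ?N = "enn2real (green_norm s (g A L))"
      have pos: "0 \<le> M * (A / L powr d)"
        using M that by simp
      have "green_norm s (g A L) < \<infinity>" and meas: "g A L \<in> borel_measurable borel"
        using g_space(3)[OF that] by (auto simp: green_space_def)
      then have N: "ennreal ?N = green_norm s (g A L)"
        by simp
      have "ennreal (M * (A / L powr d)) \<le> ennreal ?N"
        unfolding N unfolding green_norm_def g_norm[OF that, symmetric] g_norm_at[OF that, symmetric]
        by (rule SUP_upper) simp
      then show "M * (A / L powr d) \<le> ?N"
        by (simp add: ennreal_le_iff del: times_divide_eq_right)
      have "ennreal ?N \<le> ennreal (1 + k) * ennreal (M * (A / L powr d))"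
        unfolding N unfolding green_norm_def g_norm[OF that, symmetric] by (rule SUP_least) (rule k(2)[OF meas])
      also have "\<dots> = ennreal ((1 + k) * (M * (A / L powr d)))"
        using k(1) pos by (simp only: ennreal_mult)
      finally show "?N \<le> (1 + k) * (M * (A / L powr d))"
        using k(1) pos by (subst (asm) ennreal_le_iff) (rule mult_nonneg_nonneg, simp_all)
      show "short_time_bound m a b C (cball z 1) ?N (u (g A L))"
      proof (rule short_time_bound_mono[OF cball(1)])
        show "short_time_bound m a b C UNIV ?N (u (g A L))"
          using C g_space[OF that] g_pos[OF that] g_not_null[OF that] by metis
      qed (rule u_meas[OF that])
    qed
    with \<open>C > 0\<close> k(1) show thesis
      by (intro that[of C "1 + k"]) auto
  qed

  \<comment> \<open>A mild solution with datum \<open>f\<close> is extracted from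
    \<open>u f\<close>, through the constant approximating sequence.\<close>
  have "the_weak_dual_solution s m f (u f)"
    using u[of f] f_space f_pos by (auto simp: nonneg_ae_def)
  moreover have "approximates_from_below (\<lambda>k. f) f"
    using f_space f_pos by (simp add: approximates_from_below_def nonneg_ae_def)
  ultimately obtain U where U: "mild_solution s m f U"
    unfolding the_weak_dual_solution_def by blast
  obtain \<tau> where \<tau>: "0 < \<tau>" "\<not> null_ae (U \<tau>)"
    using mild_solution_eventually_not_null[OF U _ f_not_null] f_space by blast
  obtain e R where e: "0 < e" and R: "\<not> (AE x in lborel. x \<in> cball z R \<longrightarrow> \<bar>U \<tau> x\<bar> \<le> e)"
    using not_null_ae_lower_bound[OF \<tau>(2)] by blast
  have [measurable]: "U \<tau> \<in> borel_measurable borel"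
    using U \<tau> by (auto simp: mild_solution_def L1_space_def)
  \<comment> \<open>The entries ensure, in order: support of the datum in the unit ball, transport
    of the ball of radius \<open>R\<close> into the unit ball, and admissibility of the time
    \<open>\<tau> / B\<close>.\<close>
  define L0 where "L0 = max 1 (max R ((\<tau> * (D * M) powr (m - 1)) powr (1 / (2 * s))))"
  define Q where "Q = C * \<tau> powr (- a) * D powr \<bar>b\<bar> * M powr b / e"
  have Q: "0 < Q"
    using C D M \<tau> e by (simp add: Q_def)
  have "A \<le> Q * (A powr (m - 1) * L powr (2 * s)) powr a * (A / L powr d) powr b"
    if A: "0 < A" and L: "L0 \<le> L" for A L
  proof -
    define B where "B = A powr (m - 1) * L powr (2 * s)"
    define N0 where "N0 = M * (A / L powr d)"
    define c where "c = z - L *\<^sub>R z"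
    have L1: "1 \<le> L" and LR: "R \<le> L" and Lt: "(\<tau> * (D * M) powr (m - 1)) powr (1 / (2 * s)) \<le> L"
      using L by (auto simp: L0_def)
    then have "((\<tau> * (D * M) powr (m - 1)) powr (1 / (2 * s))) powr (2 * s) \<le> L powr (2 * s)"
      using s by (intro powr_mono2) auto
    then have Ls: "\<tau> * (D * M) powr (m - 1) \<le> L powr (2 * s)"
      using s \<tau> by (simp add: powr_powr)
    have B: "0 < B" and N0: "0 < N0"
      using A L1 M by (simp_all add: B_def N0_def)
    obtain N where N: "N0 \<le> N" "N \<le> D * N0" and stb: "short_time_bound m a b C (cball z 1) N (u (g A L))"
      using bound[OF A L1] by (auto simp: N0_def)
    \<comment> \<open>The power of \<open>A\<close> is the same here and in \<open>B\<close>, so the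
      choice of \<open>L0\<close> suffices for every \<open>A\<close>; the denominator is at least 1
      and is dropped.\<close>
    have "\<tau> * (D * N0) powr (m - 1) = \<tau> * (D * M) powr (m - 1) * A powr (m - 1) / (L powr d) powr (m - 1)"
      by (simp add: N0_def powr_mult powr_divide)
    also have "\<dots> \<le> L powr (2 * s) * A powr (m - 1) / 1"
      using Ls m L1 d by (intro frac_le mult_right_mono ge_one_powr_ge_zero) auto
    finally have "\<tau> * (D * N0) powr (m - 1) \<le> B"
      by (simp add: B_def mult.commute)
    then have "\<tau> / B \<le> (D * N0) powr (- (m - 1))"
    proof -
      have "0 < (D * N0) powr (m - 1)"
        using D N0 by simp
      with \<open>\<tau> * (D * N0) powr (m - 1) \<le> B\<close> B show ?thesis
        unfolding powr_minus_divide by (simp only: pos_divide_le_eq pos_le_divide_eq times_divide_eq_left)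
    qed
    also have "\<dots> \<le> N powr (- (m - 1))"
      using N N0 m by (intro powr_mono2') auto
    finally have time: "\<tau> / B \<le> N powr (- (m - 1))" .
    define P where "P = C * (\<tau> / B) powr (- a) * N powr b"
    have P: "0 \<le> P"
      using C by (simp add: P_def)
    have "Linf_norm (cball z 1) (u (g A L) (\<tau> / B)) \<le> ennreal P"
      using stb time \<tau> B by (simp add: short_time_bound_def P_def)
    then have "AE x in lborel. x \<in> cball z 1 \<longrightarrow> \<bar>u (g A L) (\<tau> / B) x\<bar> \<le> P"
      using P by (intro Linf_norm_leD) auto
    moreover have "AE x in lborel. u (g A L) (\<tau> / B) x = A * U \<tau> (c + L *\<^sub>R x)"
      using the_weak_dual_solution_affine[OF U sol[OF A L1, unfolded g_def] f_space f_pos, of "\<tau> / B"] A L1 \<tau> B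
      by (simp add: g_def c_def B_def[symmetric])
    ultimately have AE: "AE x in lborel. x \<in> cball z 1 \<longrightarrow> A * \<bar>U \<tau> (c + L *\<^sub>R x)\<bar> \<le> P"
      by eventually_elim (use A in \<open>simp add: abs_mult\<close>)
    \<comment> \<open>Otherwise the bound \<open>P\<close> on the unit ball gives |U \<tau>| \<le> e
      on its image \<open>cball z L\<close>, which contains \<open>cball z R\<close>, contrary to
      the choice of \<open>e\<close> and \<open>R\<close>.\<close>
    have "A * e < P"
    proof (rule ccontr)
      assume "\<not> A * e < P"
      then have le: "A * \<bar>v\<bar> \<le> P \<Longrightarrow> \<bar>v\<bar> \<le> e" for v
        using A by (meson mult_le_cancel_left_pos not_less order_trans)
      have dist: "dist z (c + L *\<^sub>R x) = L * dist z x" for x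
      proof -
        have "dist z (c + L *\<^sub>R x) = norm (L *\<^sub>R (z - x))"
          by (simp add: c_def dist_norm algebra_simps)
        then show ?thesis
          using L1 by (simp add: dist_norm)
      qed
      from AE have "AE x in lborel. c + L *\<^sub>R x \<in> cball z L \<longrightarrow> \<bar>U \<tau> (c + L *\<^sub>R x)\<bar> \<le> e"
        by eventually_elim (use le L1 dist in auto)
      then have "AE x in lborel. x \<in> cball z L \<longrightarrow> \<bar>U \<tau> x\<bar> \<le> e"
        using L1 by (subst (asm) AE_lborel_affine[of "\<lambda>x. x \<in> cball z L \<longrightarrow> \<bar>U \<tau> x\<bar> \<le> e"]) auto
      then have "AE x in lborel. x \<in> cball z R \<longrightarrow> \<bar>U \<tau> x\<bar> \<le> e"
        by eventually_elim (use LR in auto)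
      with R show False by simp
    qed
    also have "P \<le> C * (\<tau> / B) powr (- a) * (D powr \<bar>b\<bar> * N0 powr b)"
    proof -
      \<comment> \<open>For b \<ge> 0 the upper bound on \<open>N\<close> is used, for b < 0 the
        lower one; the absolute value in the exponent of \<open>D\<close> covers both.\<close>
      have "N powr b \<le> D powr \<bar>b\<bar> * N0 powr b"
      proof (cases "0 \<le> b")
        case True
        then have "N powr b \<le> (D * N0) powr b"
          using N N0 by (intro powr_mono2) auto
        with True show ?thesis
          by (simp add: powr_mult)
      next
        case False
        then have "N powr b \<le> 1 * N0 powr b"
          using powr_mono2'[of b N0 N] N N0 by simp
        also have "\<dots> \<le> D powr \<bar>b\<bar> * N0 powr b"
          using D by (intro mult_right_mono ge_one_powr_ge_zero) auto
        finally show ?thesis .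
      qed
      then show ?thesis
        unfolding P_def using C by (intro mult_left_mono) auto
    qed
    also have "\<dots> = Q * B powr a * (A / L powr d) powr b * e"
      using e B by (simp add: Q_def N0_def powr_mult powr_divide powr_minus field_simps)
    finally have "A \<le> Q * B powr a * (A / L powr d) powr b"
      using e by simp
    then show ?thesis
      by (simp add: B_def)
  qed
  moreover have "0 < L0"
    by (simp add: L0_def)
  ultimately show ?thesis
    unfolding alpha beta d_def[symmetric]
    by (intro exponents_from_scaling[OF s(1) d m Q])
qed

end
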